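(* Let $f:\mathbb{C}\to\mathbb{C}$ be harmonic. Suppose that $\{z_n\}_{n\ge 1}\subset\mathbb{C}$ is a sequence and $w_0\in\mathbb{C}$ is a point such that $z_n\to\infty$, $w_n=f(z_n)\to w_0$, and $J_f(z_n)>0$ for all $n$. Suppose that the following hold: (1) $d(\{z_n\},S)=\delta>0$; (2) $\inf_n J_f(z_n)=\eta^2>0$; (3) there exists $\rho\in(0,\delta)$ such that $\sup\{J_f(z)/J_f(z_n): n\ge 1,\ z\in B(z_n,\rho)\}<\infty$. If, for this $\rho$, $\sup\{|\mu_f(z)|: n\ge 1,\ z\in\overline{B(z_n,\rho)}\}<1$, then the interior of $C(f,\infty)$ is nonempty and $Val(f,w)=\infty$ for all $w$ in some neighborhood of $w_0$.
   Context: Harmonic functions are complex-valued: $f=u+iv$ with $u,v$ real harmonic functions of $(x,y)$, $z=x+iy$, and $\mathbb{C}$ is identified with $\mathbb{R}^2$. Notation: $f_z=\frac12(f_x-if_y)$, $f_{\overline z}=\frac12(f_x+if_y)$; $J_f=|f_z|^2-|f_{\overline z}|^2$ is the Jacobian; $S=\{z: J_f(z)=0\}$ is the critical set; $\mu_f=f_{\overline z}/f_z$ is the complex dilatation; $B(z_0,r)=\{z:|z-z_0|<r\}$; $d(A,B)=\inf\{|a-b|:a\in A,\ b\in B\}$ is the distance between sets (with value $+\infty$ if $B$ is empty). The cluster set $C(f,\infty)$ is the set of (finite) $w\in\mathbb{C}$ for which there is a sequence $\zeta_n\to\infty$ with $f(\zeta_n)\to w$. The valence $Val(f,w)$ is the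 number of distinct points $z\in\mathbb{C}$ with $f(z)=w$ (possibly $\infty$). *)

theory Defs
  imports
    "HOL-Complex_Analysis.Complex_Analysis"
    "HOL-Library.Extended_Real"
    "HOL-Library.Extended_Nat"
begin

text \<open>
  The plane is identified with the complex numbers, so the directions \<open>1\<close> and \<open>\<i>\<close> give the partial
  derivatives in \<open>x\<close> and \<open>y\<close>. The values are meaningful only where the derivative exists;
  existence is part of \<open>C1_plane\<close>.
\<close>

definition partial_deriv :: "complex \<Rightarrow> (complex \<Rightarrow> 'a::real_normed_vector) \<Rightarrow> complex \<Rightarrow> 'a" where
  "partial_deriv d f z = vector_derivative (\<lambda>t::real. f (z + t *\<^sub>R d)) (at 0)"

abbreviation dx :: "(complex \<Rightarrow> 'a::real_normed_vector) \<Rightarrow> complex \<Rightarrow> 'a" where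
  "dx \<equiv> partial_deriv 1"

abbreviation dy :: "(complex \<Rightarrow> 'a::real_normed_vector) \<Rightarrow> complex \<Rightarrow> 'a" where
  "dy \<equiv> partial_deriv \<i>"

definition C1_plane :: "(complex \<Rightarrow> real) \<Rightarrow> bool" where
  "C1_plane u \<longleftrightarrow>
     (\<forall>d\<in>{1, \<i>}. (\<forall>z. (\<lambda>t::real. u (z + t *\<^sub>R d)) differentiable at 0) \<and>
                 continuous_on UNIV (partial_deriv d u))"

definition C2_plane :: "(complex \<Rightarrow> real) \<Rightarrow> bool" where
  "C2_plane u \<longleftrightarrow> C1_plane u \<and> C1_plane (dx u) \<and> C1_plane (dy u)"

definition real_harmonic :: "(complex \<Rightarrow> real) \<Rightarrow> bool" where
  "real_harmonic u \<longleftrightarrow> C2_plane u \<and> (\<forall>z. dx (dx u) z + dy (dy u) z = 0)"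

definition complex_harmonic :: "(complex \<Rightarrow> complex) \<Rightarrow> bool" where
  "complex_harmonic f \<longleftrightarrow> real_harmonic (\<lambda>z. Re (f z)) \<and> real_harmonic (\<lambda>z. Im (f z))"

definition wirtinger :: "(complex \<Rightarrow> complex) \<Rightarrow> complex \<Rightarrow> complex" where
  "wirtinger f z = (dx f z - \<i> * dy f z) / 2"

definition wirtinger_bar :: "(complex \<Rightarrow> complex) \<Rightarrow> complex \<Rightarrow> complex" where
  "wirtinger_bar f z = (dx f z + \<i> * dy f z) / 2"

definition jacobian_C :: "(complex \<Rightarrow> complex) \<Rightarrow> complex \<Rightarrow> real" where
  "jacobian_C f z = (norm (wirtinger f z))\<^sup>2 - (norm (wirtinger_bar f z))\<^sup>2"

definition critical_set :: "(complex \<Rightarrow> complex) \<Rightarrow> complex set" where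
  "critical_set f = {z. jacobian_C f z = 0}"

definition dilatation :: "(complex \<Rightarrow> complex) \<Rightarrow> complex \<Rightarrow> complex" where
  "dilatation f z = wirtinger_bar f z / wirtinger f z"

text \<open>
  Unlike \<^const>\<open>setdist\<close>, which is \<open>0\<close> if one of the sets is empty, this distance
  is then \<open>\<infinity>\<close>.
\<close>

definition ext_setdist :: "'a::metric_space set \<Rightarrow> 'a set \<Rightarrow> ereal" where
  "ext_setdist A B = (INF a\<in>A. INF b\<in>B. ereal (dist a b))"

definition cluster_set_at_infinity :: "(complex \<Rightarrow> complex) \<Rightarrow> complex set" where
  "cluster_set_at_infinity f =
     {w. \<exists>\<zeta>::nat \<Rightarrow> complex. filterlim \<zeta> at_infinity sequentially \<and> (\<lambda>n. f (\<zeta> n)) \<longlonglongrightarrow> w}"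

definition valence :: "(complex \<Rightarrow> complex) \<Rightarrow> complex \<Rightarrow> enat" where
  "valence f w = (if finite {z. f z = w} then enat (card {z. f z = w}) else \<infinity>)"

end

theory Submission
  imports Defs
begin

text \<open>
  The idea is that the discs around the points \<open>z n\<close> have images that contain discs of a radius
  independent of \<open>n\<close>. The centres \<open>f (z n)\<close> of the image discs converge to \<open>w0\<close>, so a fixed disc
  around \<open>w0\<close> lies in all but finitely many of the images. Each of its points then has preimages
  near \<open>z n\<close> for all large \<open>n\<close>, hence preimages that tend to infinity, and this gives both
  conclusions (lemma \<open>values_near_infinity\<close>).

  For the uniform radius, put \<open>s = sqrt (jacobian_C f (z n))\<close>. On the ball of radius \<open>\<rho>\<close> around
  \<open>z n\<close> the Jacobian does not vanish, because the critical set is farther away, so it is positive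
  there. If \<open>k < 1\<close> bounds the dilatation, the Jacobian is comparable to the square of \<open>f\<^sub>z\<close>;
  the bound on the Jacobian ratios therefore bounds both Wirtinger derivatives by a constant
  multiple of \<open>s\<close>, while at the centre the derivative of \<open>f\<close> stretches every vector by a factor of
  at least \<open>(1 - k) * s\<close> (lemma \<open>wirtinger_bounds_by_jacobian\<close>). Since \<open>f\<close> is harmonic, \<open>f\<^sub>z\<close> and
  the conjugate of the other Wirtinger derivative are holomorphic, so that Cauchy's estimate bounds
  the variation of the derivative. Hence on a disc whose radius \<open>r\<close> depends on \<open>\<rho>\<close>, \<open>k\<close> and the
  bound for the ratios only, \<open>f\<close> is a small perturbation of its linear part at \<open>z n\<close>, and Brouwer's
  fixed point theorem shows that the image contains a disc of radius \<open>(1 - k) * s * r / 2\<close>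
  (lemma \<open>harmonic_map_covers_cball\<close>). Finally \<open>s \<ge> \<bar>\<eta>\<bar>\<close>.
\<close>

section \<open>Harmonic functions and their Wirtinger derivatives\<close>

lemma C1_plane_has_real_derivative:
  assumes "C1_plane u" "d \<in> {1, \<i>}"
  shows "((\<lambda>t. u (z + t *\<^sub>R d)) has_real_derivative partial_deriv d u (z + s *\<^sub>R d)) (at s)"
proof -
  have "(\<lambda>t. u ((z + s *\<^sub>R d) + t *\<^sub>R d)) differentiable at 0"
    using assms by (auto simp: C1_plane_def)
  then have "((\<lambda>t. u ((z + s *\<^sub>R d) + t *\<^sub>R d)) has_real_derivative partial_deriv d u (z + s *\<^sub>R d)) (at 0)"
    unfolding partial_deriv_def vector_derivative_works has_real_derivative_iff_has_vector_derivative by simp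
  moreover have "(\<lambda>t. u ((z + s *\<^sub>R d) + t *\<^sub>R d)) = (\<lambda>t. u (z + (t + s) *\<^sub>R d))"
    by (simp add: algebra_simps)
  ultimately show ?thesis
    using DERIV_shift[of "\<lambda>t. u (z + t *\<^sub>R d)" _ 0 s] by (simp add: add.commute)
qed

lemma C1_plane_continuous_partial:
  assumes "C1_plane u" "d \<in> {1, \<i>}"
  shows "continuous_on UNIV (partial_deriv d u)"
  using assms by (auto simp: C1_plane_def)

text \<open>
  The criterion by continuous partial derivatives for functions on the product of two real lines,
  carried over to the complex plane along \<open>Complex\<close>.
\<close>

lemma C1_plane_has_derivative:
  assumes "C1_plane u"
  shows "(u has_derivative (\<lambda>v. Re v * dx u z + Im v * dy u z)) (at z)"
proof -
  define U where "U = (\<lambda>x y. u (Complex x y))"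
  have line_x: "Complex 0 y + x *\<^sub>R 1 = Complex x y" for x y
    by (simp add: complex_eq_iff)
  have line_y: "Complex x 0 + y *\<^sub>R \<i> = Complex x y" for x y
    by (simp add: complex_eq_iff)
  have U_x: "((\<lambda>x. U x y) has_derivative (\<lambda>h. h * dx u (Complex x y))) (at x within UNIV)" for x y
    using C1_plane_has_real_derivative[OF assms, of 1 "Complex 0 y" x]
    by (simp add: U_def line_x has_field_derivative_def mult_commute_abs)
  have U_y: "((\<lambda>y. U x y) has_derivative blinfun_apply (blinfun_mult_right (dy u (Complex x y)))) (at y within UNIV)"
    for x y
    using C1_plane_has_real_derivative[OF assms, of \<i> "Complex x 0" y]
    by (simp add: U_def line_y has_field_derivative_def)
  have "continuous_on UNIV (\<lambda>p. dy u (Complex (fst p) (snd p)))"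
    by (rule continuous_on_compose2[OF C1_plane_continuous_partial[OF assms, of \<i>]])
       (auto intro!: continuous_intros)
  then have "isCont (\<lambda>p. dy u (Complex (fst p) (snd p))) (Re z, Im z)"
    by (simp add: continuous_on_eq_continuous_at)
  then have cont: "continuous (at (Re z, Im z) within UNIV \<times> UNIV)
      (\<lambda>(x, y). blinfun_mult_right (dy u (Complex x y)))"
    unfolding case_prod_beta UNIV_Times_UNIV
    by (rule bounded_linear.continuous[OF bounded_linear_blinfun_mult_right])
  have "((\<lambda>(x, y). U x y) has_derivative
      (\<lambda>(s, t). s * dx u (Complex (Re z) (Im z)) + blinfun_mult_right (dy u (Complex (Re z) (Im z))) t))
      (at (Re z, Im z) within UNIV \<times> UNIV)"
    by (rule has_derivative_partialsI[OF U_x U_y cont]) auto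
  then have "((\<lambda>p. U (fst p) (snd p)) has_derivative (\<lambda>p. fst p * dx u z + dy u z * snd p)) (at (Re z, Im z))"
    by (simp add: case_prod_beta')
  from has_derivative_compose[of "\<lambda>w. (Re w, Im w)" "\<lambda>v. (Re v, Im v)" z UNIV, OF _ this]
  show ?thesis
    by (simp add: U_def mult.commute has_derivative_Pair bounded_linear_Re bounded_linear_Im
        bounded_linear_imp_has_derivative)
qed

text \<open>
  The mean value theorem, applied once in each direction, turns the second difference of \<open>u\<close> over
  a small square into a mixed partial derivative. The second difference is symmetric in \<open>d\<close> and
  \<open>e\<close>, so that letting \<open>t\<close> tend to \<open>0\<close> for both orders gives the equality of mixed partials.
\<close>

lemma double_difference_mixed_partial:
  assumes "C1_plane u" "C1_plane (partial_deriv d u)" "d \<in> {1, \<i>}" "e \<in> {1, \<i>}" "t > 0"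
  obtains a b where "0 < a" "a < t" "0 < b" "b < t"
    "u (z + t *\<^sub>R d + t *\<^sub>R e) - u (z + t *\<^sub>R d) - u (z + t *\<^sub>R e) + u z
       = t\<^sup>2 * partial_deriv e (partial_deriv d u) (z + a *\<^sub>R d + b *\<^sub>R e)"
proof -
  have shift: "z + t *\<^sub>R e + s *\<^sub>R d = z + s *\<^sub>R d + t *\<^sub>R e" for s
    by (simp add: algebra_simps)
  let ?\<phi> = "\<lambda>s. u (z + s *\<^sub>R d + t *\<^sub>R e) - u (z + s *\<^sub>R d)"
  have "(?\<phi> has_real_derivative
      partial_deriv d u (z + s *\<^sub>R d + t *\<^sub>R e) - partial_deriv d u (z + s *\<^sub>R d)) (at s)" for s
    using DERIV_diff[OF C1_plane_has_real_derivative[OF assms(1,3), of "z + t *\<^sub>R e"]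
      C1_plane_has_real_derivative[OF assms(1,3), of z], of s]
    by (simp add: shift)
  from MVT2[OF \<open>t > 0\<close> this] obtain a where a: "0 < a" "a < t"
    "?\<phi> t - ?\<phi> 0 = t * (partial_deriv d u (z + a *\<^sub>R d + t *\<^sub>R e) - partial_deriv d u (z + a *\<^sub>R d))"
    by auto
  from MVT2[OF \<open>t > 0\<close> C1_plane_has_real_derivative[OF assms(2,4)]] obtain b where b: "0 < b" "b < t"
    "partial_deriv d u (z + a *\<^sub>R d + t *\<^sub>R e) - partial_deriv d u (z + a *\<^sub>R d + 0 *\<^sub>R e)
       = (t - 0) * partial_deriv e (partial_deriv d u) (z + a *\<^sub>R d + b *\<^sub>R e)"
    by blast
  have "?\<phi> t - ?\<phi> 0 = t\<^sup>2 * partial_deriv e (partial_deriv d u) (z + a *\<^sub>R d + b *\<^sub>R e)"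
    using a(3) b(3) by (simp add: power2_eq_square)
  with that[OF a(1,2) b(1,2)] show thesis
    by (simp add: algebra_simps)
qed

lemma C2_plane_mixed_partials_eq:
  assumes "C2_plane u"
  shows "dx (dy u) z = dy (dx u) z"
proof -
  have C1: "C1_plane u" "C1_plane (dx u)" "C1_plane (dy u)"
    using assms by (auto simp: C2_plane_def)
  define t where "t = (\<lambda>n. 1 / real (Suc n))"
  have t_pos: "t n > 0" for n by (simp add: t_def)
  have t_lim: "t \<longlonglongrightarrow> 0" unfolding t_def by (rule LIMSEQ_Suc[OF lim_1_over_n])
  have "\<exists>a b a' b'. 0 < a \<and> a < t n \<and> 0 < b \<and> b < t n \<and> 0 < a' \<and> a' < t n \<and> 0 < b' \<and> b' < t n \<and>
      dy (dx u) (z + a *\<^sub>R 1 + b *\<^sub>R \<i>) = dx (dy u) (z + a' *\<^sub>R \<i> + b' *\<^sub>R 1)" for n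
  proof -
    obtain a b where ab: "0 < a" "a < t n" "0 < b" "b < t n"
      "u (z + t n *\<^sub>R 1 + t n *\<^sub>R \<i>) - u (z + t n *\<^sub>R 1) - u (z + t n *\<^sub>R \<i>) + u z
         = (t n)\<^sup>2 * dy (dx u) (z + a *\<^sub>R 1 + b *\<^sub>R \<i>)"
      using double_difference_mixed_partial[OF C1(1,2) _ _ t_pos, of \<i>] by blast
    obtain a' b' where ab': "0 < a'" "a' < t n" "0 < b'" "b' < t n"
      "u (z + t n *\<^sub>R \<i> + t n *\<^sub>R 1) - u (z + t n *\<^sub>R \<i>) - u (z + t n *\<^sub>R 1) + u z
         = (t n)\<^sup>2 * dx (dy u) (z + a' *\<^sub>R \<i> + b' *\<^sub>R 1)"
      using double_difference_mixed_partial[OF C1(1,3) _ _ t_pos, of 1] by blast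
    have swap: "z + t n *\<^sub>R 1 + t n *\<^sub>R \<i> = z + t n *\<^sub>R \<i> + t n *\<^sub>R 1"
      by (simp add: algebra_simps)
    from ab(5)[unfolded swap] ab'(5) have "(t n)\<^sup>2 * dy (dx u) (z + a *\<^sub>R 1 + b *\<^sub>R \<i>)
        = (t n)\<^sup>2 * dx (dy u) (z + a' *\<^sub>R \<i> + b' *\<^sub>R 1)"
      by linarith
    then have "dy (dx u) (z + a *\<^sub>R 1 + b *\<^sub>R \<i>) = dx (dy u) (z + a' *\<^sub>R \<i> + b' *\<^sub>R 1)"
      using t_pos[of n] by simp
    with ab ab' show ?thesis by blast
  qed
  then obtain a b a' b' where
    bnd: "\<And>n. 0 < a n \<and> a n < t n" "\<And>n. 0 < b n \<and> b n < t n"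
      "\<And>n. 0 < a' n \<and> a' n < t n" "\<And>n. 0 < b' n \<and> b' n < t n"
    and eq: "\<And>n. dy (dx u) (z + a n *\<^sub>R 1 + b n *\<^sub>R \<i>) = dx (dy u) (z + a' n *\<^sub>R \<i> + b' n *\<^sub>R 1)"
    by metis
  have squeeze: "s \<longlonglongrightarrow> 0" if "\<And>n. 0 < s n \<and> s n < t n" for s :: "nat \<Rightarrow> real"
    by (rule tendsto_sandwich[OF _ _ tendsto_const t_lim]) (use that in \<open>auto intro!: always_eventually simp: less_imp_le\<close>)
  note lims = bnd[THEN squeeze]
  have "(\<lambda>n. z + a n *\<^sub>R 1 + b n *\<^sub>R \<i>) \<longlonglongrightarrow> z + 0 *\<^sub>R 1 + 0 *\<^sub>R \<i>"
    by (intro tendsto_intros lims)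
  then have "(\<lambda>n. dy (dx u) (z + a n *\<^sub>R 1 + b n *\<^sub>R \<i>)) \<longlonglongrightarrow> dy (dx u) z"
    using continuous_on_tendsto_compose[OF C1_plane_continuous_partial[OF C1(2), of \<i>]] by simp
  moreover have "(\<lambda>n. z + a' n *\<^sub>R \<i> + b' n *\<^sub>R 1) \<longlonglongrightarrow> z + 0 *\<^sub>R \<i> + 0 *\<^sub>R 1"
    by (intro tendsto_intros lims)
  then have "(\<lambda>n. dx (dy u) (z + a' n *\<^sub>R \<i> + b' n *\<^sub>R 1)) \<longlonglongrightarrow> dx (dy u) z"
    using continuous_on_tendsto_compose[OF C1_plane_continuous_partial[OF C1(3), of 1]] by simp
  ultimately show ?thesis
    unfolding eq by (rule LIMSEQ_unique[rotated])
qed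

text \<open>
  For \<open>g = u\<^sub>x - \<i> u\<^sub>y\<close> one Cauchy-Riemann equation is Laplace's equation and the other is the
  symmetry of the mixed partial derivatives.
\<close>

lemma real_harmonic_gradient_holomorphic:
  assumes "real_harmonic u"
  shows "(\<lambda>z. of_real (dx u z) - \<i> * of_real (dy u z)) holomorphic_on UNIV"
proof -
  have C2: "C2_plane u" and laplace: "\<And>z. dx (dx u) z + dy (dy u) z = 0"
    using assms by (auto simp: real_harmonic_def)
  then have C1: "C1_plane (dx u)" "C1_plane (dy u)"
    by (auto simp: C2_plane_def)
  have "((\<lambda>z. of_real (dx u z) - \<i> * of_real (dy u z)) has_field_derivative
      (of_real (dx (dx u) z) - \<i> * of_real (dx (dy u) z))) (at z)" for z
    unfolding has_field_derivative_def
  proof (rule has_derivative_eq_rhs)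
    show "((\<lambda>z. complex_of_real (dx u z) - \<i> * of_real (dy u z)) has_derivative
       (\<lambda>v. complex_of_real (Re v * dx (dx u) z + Im v * dy (dx u) z)
         - \<i> * of_real (Re v * dx (dy u) z + Im v * dy (dy u) z))) (at z)"
      by (intro derivative_intros C1_plane_has_derivative C1)
    have "dy (dy u) z = - dx (dx u) z" using laplace[of z] by linarith
    then show "(\<lambda>v. complex_of_real (Re v * dx (dx u) z + Im v * dy (dx u) z)
         - \<i> * of_real (Re v * dx (dy u) z + Im v * dy (dy u) z))
      = (*) (of_real (dx (dx u) z) - \<i> * of_real (dx (dy u) z))"
      by (auto simp: complex_eq_iff C2_plane_mixed_partials_eq[OF C2] algebra_simps)
  qed
  then show ?thesis
    by (auto simp: holomorphic_on_def field_differentiable_def)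
qed

lemma partial_deriv_complex:
  assumes "C1_plane (\<lambda>z. Re (f z))" "C1_plane (\<lambda>z. Im (f z))" "d \<in> {1, \<i>}"
  shows "partial_deriv d f z =
    of_real (partial_deriv d (\<lambda>z. Re (f z)) z) + \<i> * of_real (partial_deriv d (\<lambda>z. Im (f z)) z)"
proof -
  note re = C1_plane_has_real_derivative[OF assms(1,3), of z 0]
  note im = C1_plane_has_real_derivative[OF assms(2,3), of z 0]
  have "((\<lambda>t. f (z + t *\<^sub>R d)) has_vector_derivative
     Complex (partial_deriv d (\<lambda>z. Re (f z)) z) (partial_deriv d (\<lambda>z. Im (f z)) z)) (at 0)"
    using re im
    by (auto simp: has_vector_derivative_complex_iff has_real_derivative_iff_has_vector_derivative)
  then show ?thesis
    unfolding partial_deriv_def[of d f] by (simp add: vector_derivative_at Complex_eq)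
qed

lemma harmonic_C1:
  assumes "complex_harmonic f"
  shows "C1_plane (\<lambda>z. Re (f z))" "C1_plane (\<lambda>z. Im (f z))"
  using assms by (auto simp: complex_harmonic_def real_harmonic_def C2_plane_def)

text \<open>
  With \<open>g\<^sub>u = u\<^sub>x - \<i> u\<^sub>y\<close> and \<open>g\<^sub>v = v\<^sub>x - \<i> v\<^sub>y\<close> for \<open>f = u + \<i> v\<close>, the derivative \<open>f\<^sub>z\<close> is
  \<open>(g\<^sub>u + \<i> g\<^sub>v) / 2\<close> and the conjugate of the other Wirtinger derivative is \<open>(g\<^sub>u - \<i> g\<^sub>v) / 2\<close>.
\<close>

lemma harmonic_wirtinger_holomorphic:
  assumes "complex_harmonic f"
  shows "wirtinger f holomorphic_on UNIV"
proof -
  have "wirtinger f = (\<lambda>z. ((of_real (dx (\<lambda>z. Re (f z)) z) - \<i> * of_real (dy (\<lambda>z. Re (f z)) z))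
     + \<i> * (of_real (dx (\<lambda>z. Im (f z)) z) - \<i> * of_real (dy (\<lambda>z. Im (f z)) z))) / 2)"
    by (auto simp: fun_eq_iff wirtinger_def partial_deriv_complex[OF harmonic_C1[OF assms]] algebra_simps)
  then show ?thesis
    using assms by (auto simp: complex_harmonic_def intro!: holomorphic_intros real_harmonic_gradient_holomorphic)
qed

lemma harmonic_cnj_wirtinger_bar_holomorphic:
  assumes "complex_harmonic f"
  shows "(\<lambda>z. cnj (wirtinger_bar f z)) holomorphic_on UNIV"
proof -
  have "(\<lambda>z. cnj (wirtinger_bar f z)) =
     (\<lambda>z. ((of_real (dx (\<lambda>z. Re (f z)) z) - \<i> * of_real (dy (\<lambda>z. Re (f z)) z))
     - \<i> * (of_real (dx (\<lambda>z. Im (f z)) z) - \<i> * of_real (dy (\<lambda>z. Im (f z)) z))) / 2)"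
    by (auto simp: fun_eq_iff wirtinger_bar_def partial_deriv_complex[OF harmonic_C1[OF assms]] algebra_simps)
  then show ?thesis
    using assms by (auto simp: complex_harmonic_def intro!: holomorphic_intros real_harmonic_gradient_holomorphic)
qed

lemma harmonic_has_derivative:
  assumes "complex_harmonic f"
  shows "(f has_derivative (\<lambda>v. wirtinger f z * v + wirtinger_bar f z * cnj v)) (at z)"
proof -
  have "((\<lambda>z. complex_of_real (Re (f z)) + \<i> * of_real (Im (f z))) has_derivative
      (\<lambda>v. complex_of_real (Re v * dx (\<lambda>z. Re (f z)) z + Im v * dy (\<lambda>z. Re (f z)) z)
        + \<i> * of_real (Re v * dx (\<lambda>z. Im (f z)) z + Im v * dy (\<lambda>z. Im (f z)) z))) (at z)"
    by (intro derivative_intros C1_plane_has_derivative harmonic_C1[OF assms])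
  moreover have "(\<lambda>z. complex_of_real (Re (f z)) + \<i> * of_real (Im (f z))) = f"
    by (simp add: complex_eq[symmetric])
  moreover have "(\<lambda>v. complex_of_real (Re v * dx (\<lambda>z. Re (f z)) z + Im v * dy (\<lambda>z. Re (f z)) z)
        + \<i> * of_real (Re v * dx (\<lambda>z. Im (f z)) z + Im v * dy (\<lambda>z. Im (f z)) z))
     = (\<lambda>v. wirtinger f z * v + wirtinger_bar f z * cnj v)"
    by (auto simp: fun_eq_iff complex_eq_iff wirtinger_def wirtinger_bar_def
        partial_deriv_complex[OF harmonic_C1[OF assms]] field_simps)
  ultimately show ?thesis by simp
qed

section \<open>Discs covered by a harmonic mapping\<close>

text \<open>
  A quantitative inverse function theorem, surjectivity part only: solving \<open>F x = w\<close> amounts to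
  finding a fixed point of the Newton map \<open>T x = x + L' (w - F x)\<close>, where \<open>L'\<close> is the inverse of
  \<open>L\<close>. This map sends the closed ball to itself because the error of the linear approximation and the displacement of \<open>w\<close> each use up
  half of the room \<open>m * r\<close>. Brouwer's theorem supplies the fixed point.
\<close>

lemma perturbed_linear_map_covers_cball:
  fixes F L :: "'a::euclidean_space \<Rightarrow> 'a"
  assumes L: "linear L" "\<And>v. m * norm v \<le> norm (L v)" and "m > 0" "r > 0"
    and cont: "continuous_on (cball c r) F"
    and near: "\<And>x. x \<in> cball c r \<Longrightarrow> norm (F x - F c - L (x - c)) \<le> m * r / 2"
  shows "cball (F c) (m * r / 2) \<subseteq> F ` cball c r"
proof
  fix w assume w: "w \<in> cball (F c) (m * r / 2)"
  have "inj L"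
  proof (rule linear_injective_0[OF L(1), THEN iffD2], intro allI impI)
    fix v assume "L v = 0"
    with L(2)[of v] \<open>m > 0\<close> show "v = 0" by (simp add: mult_le_0_iff)
  qed
  then obtain L' where L': "linear L'" "\<And>v. L (L' v) = v" "\<And>v. L' (L v) = v"
    using linear_injective_isomorphism[OF L(1)] by blast
  have L'_bound: "norm (L' v) \<le> norm v / m" for v
    using L(2)[of "L' v"] \<open>m > 0\<close> by (simp add: L'(2) field_simps)
  \<comment> \<open>This form shows that the ball is mapped to itself; \<open>T_eq\<close> shows what a fixed point means.\<close>
  define T where "T = (\<lambda>x. c + L' (w - F c - (F x - F c - L (x - c))))"
  have T_eq: "T x = x + L' (w - F x)" for x
  proof -
    have "w - F c - (F x - F c - L (x - c)) = (w - F x) + L (x - c)" by simp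
    then have "L' (w - F c - (F x - F c - L (x - c))) = L' (w - F x) + L' (L (x - c))"
      using linear_add[OF L'(1)] by metis
    then show ?thesis unfolding T_def by (simp add: L'(3))
  qed
  have "continuous_on (cball c r) T"
    unfolding T_eq by (intro continuous_intros cont
        bounded_linear.continuous_on[OF linear_conv_bounded_linear[THEN iffD1, OF L'(1)]])
  moreover have "T ` cball c r \<subseteq> cball c r"
  proof
    fix y assume "y \<in> T ` cball c r"
    then obtain x where x: "x \<in> cball c r" "y = T x" by blast
    define v where "v = w - F c - (F x - F c - L (x - c))"
    have "norm v \<le> m * r / 2 + m * r / 2"
      using norm_triangle_le_diff[of "w - F c" "F x - F c - L (x - c)"] near[OF x(1)] w
      by (simp add: v_def dist_norm norm_minus_commute)
    then have "norm v / m \<le> r" using \<open>m > 0\<close> by (simp add: field_simps)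
    then have "norm (L' v) \<le> r" using L'_bound[of v] by linarith
    moreover have "y = c + L' v" by (simp only: x(2) T_def v_def)
    ultimately show "y \<in> cball c r" by (simp add: dist_norm)
  qed
  ultimately obtain x where x: "x \<in> cball c r" "T x = x"
    using brouwer_ball[OF \<open>r > 0\<close>, of c T] by blast
  then have "L' (w - F x) = 0" by (simp add: T_eq)
  then have "w - F x = 0" using L'(2)[of "w - F x"] linear_0[OF L(1)] by simp
  with x(1) show "w \<in> F ` cball c r" by auto
qed

text \<open>
  Discs of radius \<open>\<rho> / 2\<close> around the points of the small disc stay inside the large one, so
  Cauchy's estimate bounds the derivative there by \<open>2 * M / \<rho>\<close>.
\<close>

lemma bounded_holomorphic_variation:
  assumes hol: "h holomorphic_on ball c \<rho>"
    and bound: "\<And>x. x \<in> ball c \<rho> \<Longrightarrow> norm (h x) \<le> M"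
    and "r < \<rho> / 2" and x: "x \<in> cball c r"
  shows "norm (h x - h c) \<le> 2 * M / \<rho> * r"
proof -
  have r: "0 \<le> r" using x by (meson dual_order.trans mem_cball zero_le_dist)
  then have \<rho>: "0 < \<rho>" using \<open>r < \<rho> / 2\<close> by linarith
  have sub: "cball y (\<rho> / 2) \<subseteq> ball c \<rho>" if "y \<in> cball c r" for y
  proof
    fix v assume "v \<in> cball y (\<rho> / 2)"
    with that \<open>r < \<rho> / 2\<close> show "v \<in> ball c \<rho>"
      using dist_triangle[of c v y] by auto
  qed
  have "norm (h x - h c) \<le> 2 * M / \<rho> * norm (x - c)"
  proof (rule field_differentiable_bound[OF convex_cball])
    fix y assume y: "y \<in> cball c r"
    have "norm ((deriv ^^ 1) h y) \<le> fact 1 * M / (\<rho> / 2) ^ 1"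
    proof (rule Cauchy_inequality)
      show "h holomorphic_on ball y (\<rho> / 2)"
        using hol sub[OF y] ball_subset_cball holomorphic_on_subset by blast
      show "continuous_on (cball y (\<rho> / 2)) h"
        using hol sub[OF y] holomorphic_on_imp_continuous_on continuous_on_subset by blast
      show "norm (h v) \<le> M" if "norm (y - v) = \<rho> / 2" for v
        using that sub[OF y] by (intro bound) (auto simp: dist_norm)
    qed (use \<rho> in simp)
    then show "norm (deriv h y) \<le> 2 * M / \<rho>" by (simp add: mult.commute)
    have "y \<in> cball y (\<rho> / 2)" using \<rho> by simp
    then have "y \<in> ball c \<rho>" using sub[OF y] by blast
    then show "(h has_field_derivative deriv h y) (at y within cball c r)"
      using holomorphic_derivI[OF hol open_ball] has_field_derivative_at_within by blast
  qed (use x r in auto)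
  also have "\<dots> \<le> 2 * M / \<rho> * r"
  proof (rule mult_left_mono)
    have "0 \<le> M" using bound[of c] \<rho> norm_ge_zero[of "h c"] by (simp add: order_trans[OF norm_ge_zero])
    then show "0 \<le> 2 * M / \<rho>" using \<rho> by simp
    show "norm (x - c) \<le> r" using x by (simp add: dist_norm norm_minus_commute)
  qed
  finally show ?thesis .
qed

text \<open>
  A Bloch-type covering theorem. The lower bound \<open>m\<close> concerns the centre alone; that the
  derivative stays close to its value there follows from the upper bound \<open>M\<close>, since \<open>a\<close> and the
  conjugate of \<open>b\<close> are holomorphic and Cauchy's estimate applies. The radius \<open>r\<close> is such that each
  of the two coefficients varies by at most \<open>m / 4\<close>, and it depends on \<open>m\<close> and \<open>M\<close> only through the
  ratio \<open>m / M\<close>, so that \<open>F\<close> may be rescaled without changing it.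
\<close>

lemma harmonic_map_covers_cball:
  fixes F a b :: "complex \<Rightarrow> complex"
  assumes deriv: "\<And>x. x \<in> ball c \<rho> \<Longrightarrow> (F has_derivative (\<lambda>v. a x * v + b x * cnj v)) (at x)"
    and hol: "a holomorphic_on ball c \<rho>" "(\<lambda>x. cnj (b x)) holomorphic_on ball c \<rho>"
    and bound: "\<And>x. x \<in> ball c \<rho> \<Longrightarrow> norm (a x) \<le> M" "\<And>x. x \<in> ball c \<rho> \<Longrightarrow> norm (b x) \<le> M"
    and "0 < \<rho>" "0 < m" and m: "m \<le> norm (a c) - norm (b c)"
    and r_def: "r = m * \<rho> / (8 * M)"
  shows "cball (F c) (m * r / 2) \<subseteq> F ` cball c r"
proof (rule perturbed_linear_map_covers_cball)
  let ?L = "\<lambda>v. a c * v + b c * cnj v"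
  have "m \<le> M" using m bound(1)[of c] \<open>0 < \<rho>\<close> norm_ge_zero[of "b c"]
    by (smt (verit) centre_in_ball)
  with \<open>0 < m\<close> have "0 < M" by linarith
  then have "r \<le> \<rho> / 8"
    using \<open>m \<le> M\<close> \<open>0 < \<rho>\<close> by (simp add: r_def field_simps)
  show r: "0 < r" using \<open>0 < m\<close> \<open>0 < \<rho>\<close> \<open>0 < M\<close> by (simp add: r_def)
  have r_less: "r < \<rho> / 2" "r < \<rho>" using \<open>r \<le> \<rho> / 8\<close> \<open>0 < \<rho>\<close> by auto
  have in_ball: "x \<in> ball c \<rho>" if "x \<in> cball c r" for x
    using that r_less by auto
  show "linear ?L"
    by (intro bounded_linear.linear has_derivative_bounded_linear[OF deriv]) (simp add: \<open>0 < \<rho>\<close>)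
  show "m * norm v \<le> norm (?L v)" for v
  proof -
    have "m * norm v \<le> (norm (a c) - norm (b c)) * norm v"
      using m by (intro mult_right_mono) auto
    also have "\<dots> = norm (a c * v) - norm (b c * cnj v)"
      by (simp add: norm_mult left_diff_distrib)
    also have "\<dots> \<le> norm (?L v)" by (rule norm_diff_ineq)
    finally show ?thesis .
  qed
  have deriv_r: "(F has_derivative (\<lambda>v. a x * v + b x * cnj v)) (at x within cball c r)"
    if "x \<in> cball c r" for x
    by (rule has_derivative_at_withinI[OF deriv[OF in_ball[OF that]]])
  then show "continuous_on (cball c r) F"
    by (rule has_derivative_continuous_on)
  show "norm (F x - F c - ?L (x - c)) \<le> m * r / 2" if x: "x \<in> cball c r" for x
  proof -
    let ?G = "\<lambda>x. F x - ?L (x - c)"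
    have "norm (?G x - ?G c) \<le> m / 2 * norm (x - c)"
    proof (rule differentiable_bound[OF convex_cball])
      fix y assume y: "y \<in> cball c r"
      show "(?G has_derivative (\<lambda>v. (a y * v + b y * cnj v) - ?L v)) (at y within cball c r)"
        by (rule derivative_eq_intros deriv_r[OF y] refl)+ (auto simp: fun_eq_iff)
      have "norm (a y - a c) \<le> m / 4"
        using bounded_holomorphic_variation[OF hol(1) bound(1) r_less(1) y] \<open>0 < M\<close> \<open>0 < \<rho>\<close>
        by (simp add: r_def)
      moreover have "norm (b y - b c) \<le> m / 4"
        using bounded_holomorphic_variation[OF hol(2) _ r_less(1) y, of M] bound(2) \<open>0 < M\<close> \<open>0 < \<rho>\<close>
        by (simp add: r_def flip: complex_cnj_diff)
      ultimately have "norm (a y - a c) + norm (b y - b c) \<le> m / 2" by linarith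
      show "onorm (\<lambda>v. (a y * v + b y * cnj v) - ?L v) \<le> m / 2"
      proof (rule onorm_le)
        fix v
        have "norm ((a y * v + b y * cnj v) - ?L v) = norm ((a y - a c) * v + (b y - b c) * cnj v)"
          by (simp add: algebra_simps)
        also have "\<dots> \<le> (norm (a y - a c) + norm (b y - b c)) * norm v"
          by (rule order_trans[OF norm_triangle_ineq]) (simp add: norm_mult distrib_right)
        also have "\<dots> \<le> m / 2 * norm v"
          by (rule mult_right_mono) (fact, simp)
        finally show "norm ((a y * v + b y * cnj v) - ?L v) \<le> m / 2 * norm v" .
      qed
    qed (use x r in auto)
    also have "\<dots> \<le> m / 2 * r"
      using x \<open>0 < m\<close> by (simp add: dist_norm norm_minus_commute)
    finally show ?thesis by (simp add: algebra_simps)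
  qed
qed fact+

section \<open>The points of the sequence\<close>

lemma connected_nonvanishing_pos:
  fixes g :: "'a::topological_space \<Rightarrow> real"
  assumes "connected S" "continuous_on S g" "\<And>x. x \<in> S \<Longrightarrow> g x \<noteq> 0"
    and "x \<in> S" "g x > 0" "y \<in> S"
  shows "g y > 0"
proof (rule ccontr)
  assume "\<not> g y > 0"
  moreover have "connected (g ` S)" using assms(1,2) by (rule connected_continuous_image[rotated])
  ultimately have "0 \<in> g ` S"
    using assms(4-6) by (meson connectedD_interval image_eqI less_imp_le not_le)
  with assms(3) show False by auto
qed

text \<open>
  Preimages of \<open>w\<close> at bounded distance from every late \<open>z n\<close> tend to infinity, so they show
  that \<open>w\<close> is a cluster value and that its preimage is unbounded.
\<close>

lemma values_near_infinity:
  fixes z :: "nat \<Rightarrow> complex"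
  assumes z: "filterlim z at_infinity sequentially"
    and hits: "\<forall>\<^sub>F n in sequentially. \<exists>\<zeta>\<in>ball (z n) \<rho>. f \<zeta> = w"
  shows "w \<in> cluster_set_at_infinity f" "valence f w = \<infinity>"
proof -
  from hits obtain N where N: "\<And>n. n \<ge> N \<Longrightarrow> \<exists>\<zeta>\<in>ball (z n) \<rho>. f \<zeta> = w"
    by (auto simp: eventually_sequentially)
  have "\<exists>\<zeta>\<in>ball (z (n + N)) \<rho>. f \<zeta> = w" for n using N by simp
  then obtain \<zeta> where \<zeta>: "\<And>n. \<zeta> n \<in> ball (z (n + N)) \<rho>" "\<And>n. f (\<zeta> n) = w" by metis
  have lim: "filterlim \<zeta> at_infinity sequentially"
    unfolding filterlim_at_infinity_conv_norm_at_top
  proof (rule filterlim_at_top_mono)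
    have "filterlim (\<lambda>n. z (n + N)) at_infinity sequentially"
      by (rule filterlim_compose[OF z filterlim_add_const_nat_at_top])
    then have "filterlim (\<lambda>n. norm (z (n + N))) at_top sequentially"
      by (simp add: filterlim_at_infinity_conv_norm_at_top)
    then show "filterlim (\<lambda>n. - \<rho> + norm (z (n + N))) at_top sequentially"
      by (intro filterlim_tendsto_add_at_top[OF tendsto_const])
    show "\<forall>\<^sub>F n in sequentially. - \<rho> + norm (z (n + N)) \<le> norm (\<zeta> n)"
      using \<zeta>(1) norm_triangle_ineq2[of "z (_ + N)" "\<zeta> _"]
      by (intro always_eventually allI) (smt (verit) dist_norm mem_ball norm_triangle_ineq2)
  qed
  with \<zeta>(2) show "w \<in> cluster_set_at_infinity f"
    unfolding cluster_set_at_infinity_def by force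
  have "infinite {z. f z = w}"
  proof
    assume "finite {z. f z = w}"
    then have "bounded {z. f z = w}" by (rule finite_imp_bounded)
    then obtain B where "\<And>x. f x = w \<Longrightarrow> norm x \<le> B" by (auto simp: bounded_iff)
    with \<zeta>(2) have "norm (\<zeta> n) \<le> B" for n by blast
    moreover have "\<forall>\<^sub>F n in sequentially. norm (\<zeta> n) > B"
      using lim by (simp add: filterlim_at_infinity_conv_norm_at_top filterlim_at_top_dense)
    ultimately show False by (auto simp: eventually_sequentially not_less[symmetric])
  qed
  then show "valence f w = \<infinity>" by (simp add: valence_def)
qed

text \<open>
  A bound \<open>k < 1\<close> on the dilatation makes the Jacobian comparable to the square of \<open>f\<^sub>z\<close>.
  Positivity of the Jacobian excludes \<open>f\<^sub>z = 0\<close>, where the quotient defining the dilatation has the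
  uninformative value \<open>0\<close>.
\<close>

lemma wirtinger_bounds_by_jacobian:
  assumes pos: "jacobian_C f x > 0" and dil: "norm (dilatation f x) \<le> k" and "k < 1"
  shows "norm (wirtinger_bar f x) \<le> k * norm (wirtinger f x)"
    and "sqrt (jacobian_C f x) \<le> norm (wirtinger f x)"
    and "(norm (wirtinger f x))\<^sup>2 \<le> jacobian_C f x / (1 - k\<^sup>2)"
proof -
  let ?a = "norm (wirtinger f x)" and ?b = "norm (wirtinger_bar f x)"
  have J: "jacobian_C f x = ?a\<^sup>2 - ?b\<^sup>2" by (simp add: jacobian_C_def)
  have a: "?a > 0"
  proof (rule ccontr)
    assume "\<not> ?a > 0"
    then have "jacobian_C f x \<le> 0" by (simp add: J)
    with pos show False by simp
  qed
  have "0 \<le> k" using dil norm_ge_zero order_trans by blast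
  show b: "?b \<le> k * ?a"
    using dil a by (simp add: dilatation_def norm_divide field_simps)
  show "sqrt (jacobian_C f x) \<le> ?a"
    by (rule real_le_lsqrt) (auto simp: J)
  have "?b\<^sup>2 \<le> k\<^sup>2 * ?a\<^sup>2"
    using power_mono[OF b, of 2] by (simp add: power_mult_distrib)
  moreover have "k\<^sup>2 < 1" using \<open>0 \<le> k\<close> \<open>k < 1\<close> by (simp add: power_less_one_iff)
  ultimately show "?a\<^sup>2 \<le> jacobian_C f x / (1 - k\<^sup>2)"
    by (simp add: J field_simps)
qed

lemma ereal_Sup_less_bound:
  assumes "Sup {ereal (g n x) |n x. x \<in> S n} < c" "0 \<le> g i y" "y \<in> S i"
  obtains K where "0 \<le> K" "ereal K < c" "\<And>n x. x \<in> S n \<Longrightarrow> g n x \<le> K"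
proof -
  let ?K = "Sup {ereal (g n x) |n x. x \<in> S n}"
  have le: "ereal (g n x) \<le> ?K" if "x \<in> S n" for n x
    using that by (intro Sup_upper) blast
  have "0 \<le> ?K" using le[OF assms(3)] assms(2) by (meson ereal_less_eq(5) order_trans)
  moreover have "?K \<noteq> \<infinity>" using assms(1) by auto
  ultimately obtain K where K: "?K = ereal K" "0 \<le> K"
    by (cases ?K) auto
  with that[of K] le assms(1) show thesis by auto
qed

theorem theorem5:
  fixes f :: "complex \<Rightarrow> complex" and z :: "nat \<Rightarrow> complex" and w0 :: complex
    and \<delta> :: ereal and \<eta> \<rho> :: real
  assumes "complex_harmonic f"
    and "filterlim z at_infinity sequentially"
    and "(\<lambda>n. f (z n)) \<longlonglongrightarrow> w0"
    and "\<And>n. jacobian_C f (z n) > 0"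
    and "ext_setdist (range z) (critical_set f) = \<delta>" and "\<delta> > 0"
    and "(INF n. jacobian_C f (z n)) = \<eta>\<^sup>2" and "\<eta>\<^sup>2 > 0"
    and "0 < \<rho>" and "ereal \<rho> < \<delta>"
    and "Sup {ereal (jacobian_C f \<zeta> / jacobian_C f (z n)) | n \<zeta>. \<zeta> \<in> ball (z n) \<rho>} < \<infinity>"
    and "Sup {ereal (norm (dilatation f \<zeta>)) | n \<zeta>. \<zeta> \<in> closure (ball (z n) \<rho>)} < 1"
  shows "interior (cluster_set_at_infinity f) \<noteq> {} \<and>
         (\<forall>\<^sub>F w in nhds w0. valence f w = \<infinity>)"
proof -
  note J_pos = assms(4)
  note hol = harmonic_wirtinger_holomorphic[OF assms(1)]
    harmonic_cnj_wirtinger_bar_holomorphic[OF assms(1)]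
  have centre: "z n \<in> ball (z n) \<rho>" for n using \<open>0 < \<rho>\<close> by simp
  obtain C where C: "0 \<le> C" "\<And>n \<zeta>. \<zeta> \<in> ball (z n) \<rho> \<Longrightarrow> jacobian_C f \<zeta> / jacobian_C f (z n) \<le> C"
    using ereal_Sup_less_bound[OF assms(11) _ centre] J_pos by (metis less_imp_le divide_nonneg_nonneg)
  then have "1 \<le> C" using J_pos[of 0] C(2)[OF centre[of 0]] by simp
  obtain k where k: "0 \<le> k" "k < 1" "\<And>n \<zeta>. \<zeta> \<in> closure (ball (z n) \<rho>) \<Longrightarrow> norm (dilatation f \<zeta>) \<le> k"
    using ereal_Sup_less_bound[OF assms(12) norm_ge_zero, of "z 0" 0] centre closure_subset
    by (metis ereal_less(3) one_ereal_def less_ereal.simps(1) subsetD)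
  have k2: "k\<^sup>2 < 1" using k(1,2) by (simp add: power_less_one_iff)
  have jac_cont: "continuous_on UNIV (jacobian_C f)"
  proof -
    have "continuous_on UNIV (wirtinger_bar f)"
      using continuous_on_cnj[OF holomorphic_on_imp_continuous_on[OF hol(2)]] by simp
    then show ?thesis
      unfolding jacobian_C_def[abs_def]
      using holomorphic_on_imp_continuous_on[OF hol(1)] by (intro continuous_intros)
  qed
  have J_ball: "jacobian_C f x > 0" if x: "x \<in> ball (z n) \<rho>" for n x
  proof (rule connected_nonvanishing_pos[where g = "jacobian_C f" and S = "ball (z n) \<rho>" and x = "z n"])
    show "connected (ball (z n) \<rho>)" by (rule connected_ball)
    show "continuous_on (ball (z n) \<rho>) (jacobian_C f)"
      using jac_cont continuous_on_subset by blast
    show "jacobian_C f y \<noteq> 0" if y: "y \<in> ball (z n) \<rho>" for y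
    proof
      assume "jacobian_C f y = 0"
      then have "y \<in> critical_set f" by (simp add: critical_set_def)
      then have "\<delta> \<le> ereal (dist (z n) y)"
        unfolding assms(5)[symmetric] ext_setdist_def by (intro INF_lower2[of "z n"] INF_lower2[of y]) auto
      with \<open>ereal \<rho> < \<delta>\<close> y show False
        by (metis ereal_less_eq(3) linorder_not_le mem_ball order_less_le_trans less_imp_le)
    qed
  qed (use centre J_pos x in auto)
  have J_ge: "\<eta>\<^sup>2 \<le> jacobian_C f (z n)" for n
    unfolding assms(7)[symmetric] using J_pos
    by (intro cINF_lower bdd_belowI[of _ 0]) (auto intro: less_imp_le)
  \<comment> \<open>\<open>A * sqrt (jacobian_C f (z n))\<close> bounds both Wirtinger derivatives near \<open>z n\<close>, and
    \<open>(1 - k) * sqrt (jacobian_C f (z n))\<close> is a lower bound for the stretching at \<open>z n\<close>. In the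
    quotient of the two the Jacobian cancels, hence \<open>r\<close> is the same for all \<open>n\<close>.\<close>
  define A where "A = sqrt (C / (1 - k\<^sup>2))"
  have "A > 0" using \<open>1 \<le> C\<close> k2 by (simp add: A_def)
  define r where "r = (1 - k) * \<rho> / (8 * A)"
  have "r > 0" using \<open>A > 0\<close> k \<open>0 < \<rho>\<close> by (simp add: r_def)
  define \<epsilon> where "\<epsilon> = (1 - k) * \<bar>\<eta>\<bar> * r / 2"
  have "\<epsilon> > 0" using \<open>r > 0\<close> k \<open>\<eta>\<^sup>2 > 0\<close> by (simp add: \<epsilon>_def)
  have "A \<ge> 1"
  proof -
    have "1 - k\<^sup>2 \<le> C" using \<open>1 \<le> C\<close> zero_le_power2[of k] by linarith
    then show ?thesis using k2 by (simp add: A_def field_simps)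
  qed
  have "r < \<rho>"
  proof -
    have "(1 - k) * \<rho> < 8 * A * \<rho>" using k \<open>A \<ge> 1\<close> \<open>0 < \<rho>\<close> by (intro mult_strict_right_mono) auto
    then show ?thesis using \<open>A > 0\<close> by (simp add: r_def field_simps)
  qed
  have cover: "cball (f (z n)) \<epsilon> \<subseteq> f ` ball (z n) \<rho>" for n
  proof -
    define s where "s = sqrt (jacobian_C f (z n))"
    have s: "s > 0" "\<bar>\<eta>\<bar> \<le> s" "s\<^sup>2 = jacobian_C f (z n)"
      using J_pos[of n] real_le_rsqrt[of "\<bar>\<eta>\<bar>"] J_ge[of n] by (auto simp: s_def)
    have dil: "norm (dilatation f x) \<le> k" if "x \<in> ball (z n) \<rho>" for x
      using k(3) that closure_subset by blast
    have bar: "norm (wirtinger_bar f x) \<le> k * norm (wirtinger f x)" if "x \<in> ball (z n) \<rho>" for x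
      using wirtinger_bounds_by_jacobian(1)[OF J_ball dil] that k(2) by blast
    have wirt: "norm (wirtinger f x) \<le> A * s" if x: "x \<in> ball (z n) \<rho>" for x
    proof -
      have "(norm (wirtinger f x))\<^sup>2 \<le> jacobian_C f x / (1 - k\<^sup>2)"
        using wirtinger_bounds_by_jacobian(3)[OF J_ball dil k(2)] x by blast
      also have "\<dots> \<le> C * s\<^sup>2 / (1 - k\<^sup>2)"
        using C(2)[OF x] J_pos[of n] k2 by (intro divide_right_mono) (auto simp: s(3) field_simps)
      also have "\<dots> = (A * s)\<^sup>2"
        using \<open>1 \<le> C\<close> k2 by (simp add: A_def power_mult_distrib)
      finally show ?thesis
        by (rule power2_le_imp_le) (use \<open>A > 0\<close> \<open>s > 0\<close> in simp)
    qed
    have "cball (f (z n)) ((1 - k) * s * r / 2) \<subseteq> f ` cball (z n) r"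
    proof (rule harmonic_map_covers_cball)
      show "(f has_derivative (\<lambda>v. wirtinger f x * v + wirtinger_bar f x * cnj v)) (at x)" for x
        by (rule harmonic_has_derivative[OF assms(1)])
      show "wirtinger f holomorphic_on ball (z n) \<rho>" "(\<lambda>x. cnj (wirtinger_bar f x)) holomorphic_on ball (z n) \<rho>"
        using hol holomorphic_on_subset by blast+
      show "norm (wirtinger_bar f x) \<le> A * s" if x: "x \<in> ball (z n) \<rho>" for x
        using bar[OF x] wirt[OF x] k(2) mult_right_mono[of k 1 "norm (wirtinger f x)"] by simp
      have "(1 - k) * s \<le> (1 - k) * norm (wirtinger f (z n))"
        using wirtinger_bounds_by_jacobian(2)[OF J_pos dil[OF centre] k(2)] k(2)
        by (intro mult_left_mono) (auto simp: s_def)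
      then show "(1 - k) * s \<le> norm (wirtinger f (z n)) - norm (wirtinger_bar f (z n))"
        using bar[OF centre] by (simp add: left_diff_distrib)
      show "r = (1 - k) * s * \<rho> / (8 * (A * s))"
        using \<open>s > 0\<close> by (simp add: r_def)
    qed (use wirt k s \<open>0 < \<rho>\<close> in auto)
    moreover have "\<epsilon> \<le> (1 - k) * s * r / 2"
      using s k(2) \<open>r > 0\<close> by (simp add: \<epsilon>_def)
    moreover have "cball (z n) r \<subseteq> ball (z n) \<rho>" using \<open>r < \<rho>\<close> by auto
    ultimately show ?thesis by (meson cball_subset_cball_iff image_mono order_trans subset_cball)
  qed
  have hits: "\<forall>\<^sub>F n in sequentially. \<exists>\<zeta>\<in>ball (z n) \<rho>. f \<zeta> = w" if w: "w \<in> ball w0 (\<epsilon> / 2)" for w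
  proof -
    have "\<forall>\<^sub>F n in sequentially. dist (f (z n)) w0 < \<epsilon> / 2"
      by (rule tendstoD[OF assms(3)]) (use \<open>\<epsilon> > 0\<close> in simp)
    then show ?thesis
    proof eventually_elim
      case (elim n)
      then have "w \<in> cball (f (z n)) \<epsilon>"
        using w dist_triangle[of "f (z n)" w w0] by simp
      with cover[of n] show ?case by auto
    qed
  qed
  note near = values_near_infinity[OF assms(2) hits]
  have "ball w0 (\<epsilon> / 2) \<subseteq> interior (cluster_set_at_infinity f)"
    by (intro interior_maximal subsetI near(1) open_ball)
  moreover have "w0 \<in> ball w0 (\<epsilon> / 2)" using \<open>\<epsilon> > 0\<close> by simp
  ultimately have "interior (cluster_set_at_infinity f) \<noteq> {}" by blast
  moreover have "\<forall>\<^sub>F w in nhds w0. w \<in> ball w0 (\<epsilon> / 2)"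
    using \<open>\<epsilon> > 0\<close> by (intro eventually_nhds_in_open) auto
  then have "\<forall>\<^sub>F w in nhds w0. valence f w = \<infinity>"
    by eventually_elim (rule near(2))
  ultimately show ?thesis by blast
qed

end
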